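(* Let $T=\Delta$ be the target concept. Consider the cascade consisting of the scenario program $\mathcal P[\{\delta_i\}_{i=1}^m]$ followed by the scenario program $\widetilde{\mathcal P}[x,\{\delta_i\}_{i=1}^m]$, parametric in $x\in\mathcal X$, defined in the context together with the integers $d_1,d_2$, and assume that: (i) $\mathcal X\subset\mathbb R^{n_x}$ is convex, $g(\cdot,\delta)$ is convex for every $\delta\in\Delta$, and for any $m$-multisample $\{\delta_i\}_{i=1}^m$ the feasibility region of $\mathcal P[\{\delta_i\}_{i=1}^m]$ has non-empty interior and its minimizer exists and is unique; (ii) $\mathcal Y\subset\mathbb R^{n_y}$ is convex, $\widetilde g(\cdot,x,\delta)$ is convex for every $x\in\mathcal X$ and $\delta\in\Delta$, and for any $x\in\mathcal X$ and any $m$-multisample $\{\delta_i\}_{i=1}^m$ the feasibility region of $\widetilde{\mathcal P}[x,\{\delta_i\}_{i=1}^m]$ has non-empty interior and its minimizer exists and is unique. Fix $d=d_1+d_2$ and consider $m\ge d$. Then, for any $\epsilon\in(0,1)$, $$\mathbb P^m\Big\{(\delta_1,\ldots,\delta_m)\in\Delta^m:\ \mathbb P\Big(\delta\in\Delta:\ \big(g(x_m,\delta)>0\big)\text{ or }\big(\widetilde g(y_m[x_m],x_m,\delta)>0\big)\Big)>\epsilon\Big\}\le\binom md(1-\epsilon)^{m-d},$$ where $x_m$ and $y_m[x_m]$ are the minimizers of $\mathcal P[\{\delta_i\}_{i=1}^m]$ and $\widetilde{\mathcal P}[x_m,\{\delta_i\}_{i=1}^m]$, respectively.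
   Context: $\Delta\subseteq\mathbb R^{n_\delta}$ is a set endowed with a $\sigma$-algebra $\mathcal D$, $\mathbb P$ is a probability measure on $\mathcal D$, and $\mathbb P^m$ is the product measure on $\Delta^m$; an $m$-multisample is a collection $\{\delta_i\}_{i=1}^m$ of $m$ i.i.d. samples with law $\mathbb P$. All involved sets are assumed measurable. $\mathcal X\subset\mathbb R^{n_x}$, $c\in\mathbb R^{n_x}$, $g:\mathcal X\times\Delta\to\mathbb R$; $\mathcal Y\subset\mathbb R^{n_y}$, $\tilde c\in\mathbb R^{n_y}$, $\widetilde g:\mathcal Y\times\mathcal X\times\Delta\to\mathbb R$. For a finite family of samples $\{\delta_i\}_{i\in J}$ the two programs are $\mathcal P[\{\delta_i\}_{i\in J}]$: $\min_{x\in\mathcal X}c^Tx$ subject to $g(x,\delta_i)\le0$ for all $i\in J$; $\widetilde{\mathcal P}[x,\{\delta_i\}_{i\in J}]$: $\min_{y\in\mathcal Y}\tilde c^Ty$ subject to $\widetilde g(y,x,\delta_i)\le0$ for all $i\in J$. $\mathcal I_k$ denotes the set of all $k$-element subsets of $\{1,\dots,m\}$. The target concept is the set to be approximated; with $T=\Delta$ every sample has label $\mathbf 1_T(\delta_i)=1$ ($\mathbf 1_C$ is the indicator function of $C$), and a set $H\in\mathcal D$ is consistent with the labeled samples $\{(\delta_i,\mathbf 1_T(\delta_i))\}_{i\in J}$ iff $\delta_i\in H$ for all $i\in J$. A map $G_k:[\Delta\times\{0,1\}]^k\to\mathcal D$ is said here to have the compression property (with size $k$) if: 1) for all $I_k\in\mathcal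 I_k$, $G_k(\{(\delta_i,\mathbf 1_T(\delta_i))\}_{i\in I_k})$ is consistent with $\{(\delta_i,\mathbf 1_T(\delta_i))\}_{i\in I_k}$; 2) with $\mathbb P^m$-probability one, for any labeled $m$-multisample $\{(\delta_i,\mathbf 1_T(\delta_i))\}_{i=1}^m$ with $m\ge k$, there exists $I_k\in\mathcal I_k$ such that $G_k(\{(\delta_i,\mathbf 1_T(\delta_i))\}_{i\in I_k})$ is consistent with the whole labeled $m$-multisample. The integer $d_1\in\mathbb N$ is such that the compression property (with size $d_1$) holds for the map returning $\{\delta\in\Delta: g(x_{d_1},\delta)\le0\}$, where $x_{d_1}$ is the minimizer of $\mathcal P[\{\delta_i\}_{i\in I_{d_1}}]$. The integer $d_2\le n_y$ is such that, for any $x\in\mathcal X$, the compression property (with size $d_2$) holds for the map returning $\{\delta\in\Delta:\widetilde g(y_{d_2}[x],x,\delta)\le0\}$, where $y_{d_2}[x]$ is the minimizer of $\widetilde{\mathcal P}[x,\{\delta_i\}_{i\in I_{d_2}}]$.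
   Formalization: The compression property of size d_2 is assumed with one exceptional null set of multisamples common to all x in X (with a separate null set for each x the claim is false), and the violation set of the cascade on d samples is assumed jointly measurable in the samples and δ. *)

theory Defs
  imports "HOL-Probability.Probability"
begin

subsection \<open>Scenario programs\<close>

text \<open>A program depends on its family of samples only through the set \<open>D\<close> of sampled values.
  The parametric program for a given \<open>x\<close> is obtained by instantiating \<open>g\<close> with
  \<open>\<lambda>y \<delta>. gt y x \<delta>\<close>.\<close>

definition scenario_feasible ::
  "(real^'n) set \<Rightarrow> (real^'n \<Rightarrow> 'a \<Rightarrow> real) \<Rightarrow> 'a set \<Rightarrow> (real^'n) set" where
  "scenario_feasible X g D = {x \<in> X. \<forall>\<delta>\<in>D. g x \<delta> \<le> 0}"

definition scenario_minimizer_unique ::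
  "(real^'n) set \<Rightarrow> real^'n \<Rightarrow> (real^'n \<Rightarrow> 'a \<Rightarrow> real) \<Rightarrow> 'a set \<Rightarrow> bool" where
  "scenario_minimizer_unique X c g D \<longleftrightarrow>
     (\<exists>!x. is_arg_min (\<lambda>z. c \<bullet> z) (\<lambda>z. z \<in> scenario_feasible X g D) x)"

text \<open>A choice function, hence meaningful only under \<open>scenario_minimizer_unique\<close>.\<close>

definition scenario_minimizer ::
  "(real^'n) set \<Rightarrow> real^'n \<Rightarrow> (real^'n \<Rightarrow> 'a \<Rightarrow> real) \<Rightarrow> 'a set \<Rightarrow> real^'n" where
  "scenario_minimizer X c g D = arg_min_on (\<lambda>z. c \<bullet> z) (scenario_feasible X g D)"

definition cascade_violated ::
  "(real^'n) set \<Rightarrow> real^'n \<Rightarrow> (real^'n \<Rightarrow> 'a \<Rightarrow> real) \<Rightarrow>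
   (real^'k) set \<Rightarrow> real^'k \<Rightarrow> (real^'k \<Rightarrow> real^'n \<Rightarrow> 'a \<Rightarrow> real) \<Rightarrow> 'a set \<Rightarrow> 'a \<Rightarrow> bool" where
  "cascade_violated X c g Y ct gt D \<delta> \<longleftrightarrow>
     (let x = scenario_minimizer X c g D;
          y = scenario_minimizer Y ct (\<lambda>y \<delta>. gt y x \<delta>) D
      in g x \<delta> > 0 \<or> gt y x \<delta> > 0)"

subsection \<open>Compression\<close>

text \<open>An \<open>m\<close>-multisample is a point \<open>\<omega>\<close> of the product space over \<open>{1..m}\<close>; labels are Booleans,
  with \<open>True\<close> for 1. A labeled subsample is the tuple of its entries in increasing index order.\<close>

abbreviation multisample :: "'a measure \<Rightarrow> nat \<Rightarrow> (nat \<Rightarrow> 'a) measure" where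
  "multisample M m \<equiv> Pi\<^sub>M {1..m} (\<lambda>_. M)"

definition labeled :: "'a set \<Rightarrow> (nat \<Rightarrow> 'a) \<Rightarrow> nat set \<Rightarrow> ('a \<times> bool) list" where
  "labeled T \<omega> I = map (\<lambda>i. (\<omega> i, \<omega> i \<in> T)) (sorted_list_of_set I)"

definition consistent :: "'a set \<Rightarrow> ('a \<times> bool) list \<Rightarrow> bool" where
  "consistent H L \<longleftrightarrow> (\<forall>(\<delta>, b)\<in>set L. (\<delta> \<in> H) = b)"

definition subsample_consistent ::
  "'a measure \<Rightarrow> 'a set \<Rightarrow> nat \<Rightarrow> nat \<Rightarrow> (('a \<times> bool) list \<Rightarrow> 'a set) \<Rightarrow> bool" where
  "subsample_consistent M T m k G \<longleftrightarrow>
     (\<forall>L. length L = k \<and> set L \<subseteq> space M \<times> UNIV \<longrightarrow> G L \<in> sets M) \<and>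
     (\<forall>\<omega>\<in>space (multisample M m). \<forall>I\<subseteq>{1..m}. card I = k \<longrightarrow>
        consistent (G (labeled T \<omega> I)) (labeled T \<omega> I))"

definition compresses ::
  "'a set \<Rightarrow> nat \<Rightarrow> nat \<Rightarrow> (('a \<times> bool) list \<Rightarrow> 'a set) \<Rightarrow> (nat \<Rightarrow> 'a) \<Rightarrow> bool" where
  "compresses T m k G \<omega> \<longleftrightarrow>
     (\<exists>I\<subseteq>{1..m}. card I = k \<and> consistent (G (labeled T \<omega> I)) (labeled T \<omega> {1..m}))"

definition compression_property ::
  "'a measure \<Rightarrow> 'a set \<Rightarrow> nat \<Rightarrow> nat \<Rightarrow> (('a \<times> bool) list \<Rightarrow> 'a set) \<Rightarrow> bool" where
  "compression_property M T m k G \<longleftrightarrow>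
     subsample_consistent M T m k G \<and>
     (k \<le> m \<longrightarrow> (AE \<omega> in multisample M m. compresses T m k G \<omega>))"

text \<open>The compression property for all members of a family at once: the exceptional null set
  is common to all parameters \<open>s \<in> S\<close>, although the compressing subset of indices may depend on \<open>s\<close>.
  With a null set for each single \<open>s\<close>, nothing could be said about a parameter that is itself a
  function of the samples, such as the minimizer of the first program of a cascade.\<close>

definition compression_property_family ::
  "'a measure \<Rightarrow> 'a set \<Rightarrow> nat \<Rightarrow> nat \<Rightarrow> 's set \<Rightarrow> ('s \<Rightarrow> ('a \<times> bool) list \<Rightarrow> 'a set) \<Rightarrow> bool" where
  "compression_property_family M T m k S G \<longleftrightarrow>
     (\<forall>s\<in>S. subsample_consistent M T m k (G s)) \<and>
     (k \<le> m \<longrightarrow> (AE \<omega> in multisample M m. \<forall>s\<in>S. compresses T m k (G s) \<omega>))"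

definition scenario_map ::
  "'a measure \<Rightarrow> (real^'n) set \<Rightarrow> real^'n \<Rightarrow> (real^'n \<Rightarrow> 'a \<Rightarrow> real) \<Rightarrow> ('a \<times> bool) list \<Rightarrow> 'a set" where
  "scenario_map M X c g L =
     {\<delta> \<in> space M. g (scenario_minimizer X c g (fst ` set L)) \<delta> \<le> 0}"

end

(* By compression, almost every multisample has subsets of d1 and d2 indices which already determine
   x_m and y_m[x_m]; enlarging their union to d indices changes neither minimizer. For a fixed set of
   d indices the violation set then depends on d samples only, and conditionally on these the other
   m - d samples all miss a set of probability more than epsilon with probability at most
   (1 - epsilon)^(m - d). A union bound over the index sets concludes. *)
theory Submission
  imports Defs
begin

section \<open>Minimizers of scenario programs and the index sets that determine them\<close>

lemma scenario_minimizer_arg_min: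
  assumes "scenario_minimizer_unique X c g D"
  shows "is_arg_min (\<lambda>z. c \<bullet> z) (\<lambda>z. z \<in> scenario_feasible X g D) (scenario_minimizer X c g D)"
  using assms unfolding scenario_minimizer_unique_def scenario_minimizer_def arg_min_on_def arg_min_def
  by (metis (no_types, lifting) someI_ex)

lemma scenario_feasible_antimono:
  "D \<subseteq> D' \<Longrightarrow> scenario_feasible X g D' \<subseteq> scenario_feasible X g D"
  by (auto simp: scenario_feasible_def)

text \<open>Extra constraints only shrink the feasible set, so an optimum that survives them stays
  optimal. Uniqueness for \<open>D\<close> alone is enough: it carries over to
  \<open>D'\<close>.\<close>

lemma scenario_minimizer_superset:
  assumes uniq: "scenario_minimizer_unique X c g D"
    and sub: "D \<subseteq> D'"
    and feas: "scenario_minimizer X c g D \<in> scenario_feasible X g D'"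
  shows "scenario_minimizer X c g D' = scenario_minimizer X c g D"
proof -
  let ?opt = "\<lambda>D. is_arg_min (\<lambda>z. c \<bullet> z) (\<lambda>z. z \<in> scenario_feasible X g D)"
  let ?x = "scenario_minimizer X c g D"
  have opt: "?opt D ?x"
    by (rule scenario_minimizer_arg_min[OF uniq])
  then have opt': "?opt D' ?x"
    using feas scenario_feasible_antimono[OF sub, of X g] unfolding is_arg_min_def by blast
  have "z = ?x" if z: "?opt D' z" for z
  proof -
    \<comment> \<open>As \<open>?x\<close> is feasible for \<open>D'\<close>, the value of
      \<open>z\<close> is at most that of \<open>?x\<close>, which is already the optimum over the
      larger feasible set of \<open>D\<close>.\<close>
    have "?opt D z"
      using z opt feas scenario_feasible_antimono[OF sub, of X g]
      unfolding is_arg_min_def by (meson not_less order.strict_trans2 subsetD)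
    then show ?thesis
      using uniq opt unfolding scenario_minimizer_unique_def by blast
  qed
  with opt' show ?thesis
    unfolding scenario_minimizer_def[of X c g D'] arg_min_on_def arg_min_def
    by (intro some_equality)
qed

text \<open>With target \<open>space M\<close> all labels are \<open>True\<close>, so consistency
  only asks that every sample satisfy its constraint. Order and repetitions in the labeled list
  vanish because \<open>scenario_map\<close> sees the set of values.\<close>

lemma compresses_scenario_map_iff:
  assumes \<omega>: "\<omega> \<in> space (multisample M m)"
  shows "compresses (space M) m k (scenario_map M X c g) \<omega> \<longleftrightarrow>
    (\<exists>I\<subseteq>{1..m}. card I = k \<and> (\<forall>i\<in>{1..m}. g (scenario_minimizer X c g (\<omega> ` I)) (\<omega> i) \<le> 0))"
proof -
  have sp: "\<omega> i \<in> space M" if "i \<in> {1..m}" for i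
    using \<omega> that by (auto simp: space_PiM)
  have "fst ` set (labeled (space M) \<omega> I) = \<omega> ` I" if "I \<subseteq> {1..m}" for I
    using finite_subset[OF that] by (force simp: labeled_def image_image)
  then show ?thesis
    using sp unfolding compresses_def consistent_def
    by (auto simp: scenario_map_def labeled_def cong: conj_cong)
qed

text \<open>Reindexing along an enumeration of \<open>I\<close>. It makes assumptions about
  multisamples indexed by \<open>{1..k}\<close> available for the samples with indices in any
  \<open>k\<close>-element set.\<close>

lemma multisample_subsample:
  assumes \<omega>: "\<omega> \<in> space (multisample M m)" and I: "I \<subseteq> {1..m}" "card I = k"
  obtains \<omega>' where "\<omega>' \<in> space (multisample M k)" "\<omega>' ` {1..k} = \<omega> ` I"
proof -
  have "finite I" using I(1) finite_subset by blast
  then obtain e where e: "bij_betw e {1..k} I"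
    using I(2) ex_bij_betw_nat_finite_1 by blast
  then have im: "e ` {1..k} = I" by (rule bij_betw_imp_surj_on)
  let ?w = "\<lambda>i\<in>{1..k}. \<omega> (e i)"
  have "?w \<in> space (multisample M k)"
    using \<omega> I(1) im by (auto simp: space_PiM PiE_iff)
  moreover have "?w ` {1..k} = \<omega> ` I"
    using im by (auto simp: image_image[symmetric])
  ultimately show thesis by (rule that)
qed

text \<open>The minimizer on a compressing \<open>I\<close> is feasible for the whole multisample,
  hence also for every intermediate \<open>J\<close>, and so it remains the minimizer there. Having
  this for all such \<open>J\<close> allows the index sets of the two programs to be merged and
  padded later.\<close>

lemma multisample_minimizer_compressed:
  assumes \<omega>: "\<omega> \<in> space (multisample M m)"
    and defined: "\<And>\<omega>. \<omega> \<in> space (multisample M k) \<Longrightarrow> scenario_minimizer_unique X c g (\<omega> ` {1..k})"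
    and compr: "compresses (space M) m k (scenario_map M X c g) \<omega>"
  obtains I where "I \<subseteq> {1..m}" "card I = k"
    "scenario_minimizer X c g (\<omega> ` {1..m}) \<in> scenario_feasible X g (\<omega> ` {1..m})"
    "\<And>J. I \<subseteq> J \<Longrightarrow> J \<subseteq> {1..m} \<Longrightarrow>
      scenario_minimizer X c g (\<omega> ` J) = scenario_minimizer X c g (\<omega> ` {1..m})"
proof -
  from compr obtain I where I: "I \<subseteq> {1..m}" "card I = k"
    and sat: "\<forall>i\<in>{1..m}. g (scenario_minimizer X c g (\<omega> ` I)) (\<omega> i) \<le> 0"
    unfolding compresses_scenario_map_iff[OF \<omega>] by blast
  have uniq: "scenario_minimizer_unique X c g (\<omega> ` I)"
    using multisample_subsample[OF \<omega> I] defined by metis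
  \<comment> \<open>Compression yields only the inequalities; membership in \<open>X\<close> needs
    the chosen value to be a genuine minimizer.\<close>
  then have "scenario_minimizer X c g (\<omega> ` I) \<in> X"
    using scenario_minimizer_arg_min by (fastforce simp: is_arg_min_def scenario_feasible_def)
  then have feas: "scenario_minimizer X c g (\<omega> ` I) \<in> scenario_feasible X g (\<omega> ` {1..m})"
    using sat by (auto simp: scenario_feasible_def)
  have eq: "scenario_minimizer X c g (\<omega> ` J) = scenario_minimizer X c g (\<omega> ` I)"
    if J: "I \<subseteq> J" "J \<subseteq> {1..m}" for J
    using feas scenario_feasible_antimono[OF image_mono[OF J(2)], of X g]
    by (intro scenario_minimizer_superset[OF uniq] image_mono J) auto
  note eq_m = eq[OF I(1) order_refl]
  show thesis
    by (rule that[OF I]) (use feas eq_m in metis, use eq eq_m in metis)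
qed

section \<open>Conditioning on a subsample\<close>

text \<open>By Fubini the coordinates in \<open>I\<close> can be frozen, which fixes a slice of
  \<open>S\<close>. If its probability \<open>p\<close> exceeds \<open>\<epsilon>\<close>, the
  independent coordinates in \<open>J\<close> all miss it with probability
  \<open>(1 - p) ^ card J\<close>; otherwise the section of \<open>A\<close> is empty.\<close>

lemma prob_remaining_samples_miss_le:
  fixes M :: "'a measure" and \<epsilon> :: real
  assumes prob: "prob_space M"
    and fin: "finite I" "finite J" and disj: "I \<inter> J = {}"
    and S: "S \<in> sets (Pi\<^sub>M I (\<lambda>_. M) \<Otimes>\<^sub>M M)"
    and eps: "\<epsilon> \<le> 1"
  defines "A \<equiv> {\<omega> \<in> space (Pi\<^sub>M (I \<union> J) (\<lambda>_. M)).
      measure M {\<delta> \<in> space M. (restrict \<omega> I, \<delta>) \<in> S} > \<epsilon> \<and> (\<forall>j\<in>J. (restrict \<omega> I, \<omega> j) \<notin> S)}"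
  shows "A \<in> sets (Pi\<^sub>M (I \<union> J) (\<lambda>_. M))" (is ?meas)
    and "measure (Pi\<^sub>M (I \<union> J) (\<lambda>_. M)) A \<le> (1 - \<epsilon>) ^ card J" (is ?bound)
proof -
  interpret prob_space M by (rule prob)
  interpret PP: product_prob_space "\<lambda>_. M" I
    by unfold_locales
  let ?P = "\<lambda>I. Pi\<^sub>M I (\<lambda>_. M)"
  interpret PIJ: prob_space "?P (I \<union> J)" by (rule prob_space_PiM) (rule prob)
  have slice: "{\<delta> \<in> space M. (\<omega>, \<delta>) \<in> S} = Pair \<omega> -` S" for \<omega>
    using sets.sets_into_space[OF S] by (auto simp: space_pair_measure)
  have slice_sets: "Pair \<omega> -` S \<in> sets M" for \<omega>
    using S by (rule sets_Pair1)
  have "(\<lambda>\<omega>. measure M (Pair \<omega> -` S)) \<in> borel_measurable (?P I)"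
    unfolding measure_def using measurable_emeasure_Pair[OF S] by measurable
  then have m1: "(\<lambda>\<omega>. measure M (Pair (restrict \<omega> I) -` S)) \<in> borel_measurable (?P (I \<union> J))"
    by (rule measurable_compose[OF measurable_restrict_subset[of I "I \<union> J"], rotated]) auto
  have m2: "(\<lambda>\<omega>. (restrict \<omega> I, \<omega> j)) \<in> measurable (?P (I \<union> J)) (?P I \<Otimes>\<^sub>M M)" if "j \<in> J" for j
    using that by (intro measurable_Pair measurable_restrict_subset measurable_component_singleton) auto
  show meas: ?meas
    unfolding A_def slice
    using m1 m2 S fin by measurable
  have "emeasure (?P (I \<union> J)) A =
      (\<integral>\<^sup>+ \<omega>. indicator A \<omega> \<partial>?P (I \<union> J))"
    using meas by simp
  also have "\<dots> = (\<integral>\<^sup>+ \<omega>. \<integral>\<^sup>+ \<eta>. indicator A (merge I J (\<omega>, \<eta>)) \<partial>?P J \<partial>?P I)"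
    using meas by (intro PP.product_nn_integral_fold disj fin) auto
  also have "\<dots> \<le> (\<integral>\<^sup>+ \<omega>. ennreal ((1 - \<epsilon>) ^ card J) \<partial>?P I)"
  proof (intro nn_integral_mono)
    fix \<omega> assume \<omega>: "\<omega> \<in> space (?P I)"
    let ?B = "Pair \<omega> -` S"
    have r: "restrict (merge I J (\<omega>, \<eta>)) I = \<omega>" for \<eta>
      using \<omega> disj by (auto simp: space_PiM PiE_restrict)
    have mJ: "merge I J (\<omega>, \<eta>) j = \<eta> j" if "j \<in> J" for \<eta> j
      using that disj by (auto simp: merge_def)
    \<comment> \<open>The section of \<open>A\<close> at \<open>\<omega>\<close> lies in a product
      box, or is empty when the slice is too small; the conditional set treats both cases at
      once.\<close>
    have cover: "indicator A (merge I J (\<omega>, \<eta>)) \<le>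
        (indicator (if measure M ?B > \<epsilon> then Pi\<^sub>E J (\<lambda>_. space M - ?B) else {}) \<eta> :: ennreal)"
      if \<eta>: "\<eta> \<in> space (?P J)" for \<eta>
      using \<eta> unfolding A_def slice r
      by (auto simp: mJ r space_PiM PiE_iff split: split_indicator)
    have "(if measure M ?B > \<epsilon> then Pi\<^sub>E J (\<lambda>_. space M - ?B) else {}) \<in> sets (?P J)"
      using slice_sets fin by (auto intro!: sets_PiM_I_finite)
    then have "(\<integral>\<^sup>+ \<eta>. indicator A (merge I J (\<omega>, \<eta>)) \<partial>?P J)
        \<le> emeasure (?P J) (if measure M ?B > \<epsilon> then Pi\<^sub>E J (\<lambda>_. space M - ?B) else {})"
      by (subst nn_integral_indicator[symmetric]) (assumption, intro nn_integral_mono cover)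
    also have "\<dots> \<le> ennreal ((1 - \<epsilon>) ^ card J)"
    proof (cases "measure M ?B > \<epsilon>")
      case True
      have "emeasure (?P J) (Pi\<^sub>E J (\<lambda>_. space M - ?B)) = (\<Prod>j\<in>J. emeasure M (space M - ?B))"
        using slice_sets fin by (intro PP.emeasure_PiM) auto
      also have "\<dots> = ennreal ((1 - measure M ?B) ^ card J)"
        using slice_sets by (simp add: emeasure_eq_measure prob_compl ennreal_power)
      also have "\<dots> \<le> ennreal ((1 - \<epsilon>) ^ card J)"
        using True by (intro ennreal_leI power_mono) auto
      finally show ?thesis using True by simp
    qed simp
    finally show "(\<integral>\<^sup>+ \<eta>. indicator A (merge I J (\<omega>, \<eta>)) \<partial>?P J) \<le> ennreal ((1 - \<epsilon>) ^ card J)" .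
  qed
  also have "\<dots> = ennreal ((1 - \<epsilon>) ^ card J)"
    using prob by (simp add: prob_space.emeasure_space_1 prob_space_PiM)
  \<comment> \<open>Here \<open>\<epsilon> \<le> 1\<close> makes the bound nonnegative, so the
    inequality passes from \<open>ennreal\<close> to the reals.\<close>
  finally show ?bound
    using eps by (simp add: PIJ.emeasure_eq_measure)
qed

text \<open>Since \<open>V\<close> depends on the samples only through their set of values, any
  enumeration of \<open>I\<close> carries the measurability assumed over \<open>{1..d}\<close> to
  the coordinates in \<open>I\<close>; the previous bound then applies with the other
  \<open>m - d\<close> indices as \<open>J\<close>.\<close>

lemma prob_subsample_consistent_le:
  fixes M :: "'a measure" and \<epsilon> :: real
  assumes prob: "prob_space M"
    and I: "I \<subseteq> {1..m}" "card I = d"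
    and V: "{(\<omega>, \<delta>). \<omega> \<in> space (multisample M d) \<and> \<delta> \<in> space M \<and> V (\<omega> ` {1..d}) \<delta>}
      \<in> sets (multisample M d \<Otimes>\<^sub>M M)" (is "?S \<in> _")
    and eps: "\<epsilon> \<le> 1"
  defines "A \<equiv> {\<omega> \<in> space (multisample M m). measure M {\<delta> \<in> space M. V (\<omega> ` I) \<delta>} > \<epsilon> \<and>
      (\<forall>j\<in>{1..m} - I. \<not> V (\<omega> ` I) (\<omega> j))}"
  shows "A \<in> sets (multisample M m)"
    and "measure (multisample M m) A \<le> (1 - \<epsilon>) ^ (m - d)"
proof -
  let ?J = "{1..m} - I"
  have finI: "finite I" using I(1) finite_subset by blast
  then obtain e where e: "bij_betw e {1..d} I"
    using I(2) ex_bij_betw_nat_finite_1 by blast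
  then have im: "e ` {1..d} = I" by (rule bij_betw_imp_surj_on)
  define f where "f = (\<lambda>\<omega> :: nat \<Rightarrow> 'a. \<lambda>i\<in>{1..d}. \<omega> (e i))"
  have f: "f \<in> measurable (Pi\<^sub>M I (\<lambda>_. M)) (multisample M d)"
    unfolding f_def using im by (intro measurable_restrict measurable_component_singleton) auto
  have f_im: "f \<omega> ` {1..d} = \<omega> ` I" for \<omega>
    using im by (auto simp: f_def image_image[symmetric])
  let ?N = "Pi\<^sub>M I (\<lambda>_. M) \<Otimes>\<^sub>M M"
  define S where "S = (\<lambda>(\<omega>, \<delta>). (f \<omega>, \<delta>)) -` ?S \<inter> space ?N"
  have S: "S \<in> sets ?N"
    unfolding S_def by (intro measurable_sets[OF _ V]) (use f in measurable)
  have S_iff: "(restrict \<omega> I, \<delta>) \<in> S \<longleftrightarrow> \<delta> \<in> space M \<and> V (\<omega> ` I) \<delta>"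
    if "\<omega> \<in> space (multisample M m)" for \<omega> \<delta>
  proof -
    have "restrict \<omega> I \<in> space (Pi\<^sub>M I (\<lambda>_. M))"
      using that I(1) by (auto simp: space_PiM PiE_iff)
    moreover from this have "f (restrict \<omega> I) \<in> space (multisample M d)"
      using f by (rule measurable_space[rotated])
    moreover have "f (restrict \<omega> I) ` {1..d} = \<omega> ` I"
      unfolding f_im by simp
    ultimately show ?thesis
      by (auto simp: S_def space_pair_measure)
  qed
  have un: "I \<union> ?J = {1..m}" using I(1) by auto
  have card: "card ?J = m - d"
    using I finI by (simp add: card_Diff_subset)
  have in_space: "\<omega> j \<in> space M" if "\<omega> \<in> space (multisample M m)" "j \<in> {1..m}" for \<omega> j
    using that by (auto simp: space_PiM)
  have A_eq: "A = {\<omega> \<in> space (multisample M m).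
      measure M {\<delta> \<in> space M. (restrict \<omega> I, \<delta>) \<in> S} > \<epsilon> \<and> (\<forall>j\<in>?J. (restrict \<omega> I, \<omega> j) \<notin> S)}"
    unfolding A_def by (intro Collect_cong conj_cong refl) (auto simp: S_iff in_space)
  note * = prob_remaining_samples_miss_le[OF prob finI _ _ S eps, of ?J, unfolded un card, folded A_eq]
  show "A \<in> sets (multisample M m)" by (rule *) auto
  show "measure (multisample M m) A \<le> (1 - \<epsilon>) ^ (m - d)" by (rule *) auto
qed

section \<open>Union bound over the index sets that determine both minimizers\<close>

theorem theorem7:
  fixes M :: "(real^'nd) measure"
    and X :: "(real^'nx) set" and c :: "real^'nx" and g :: "real^'nx \<Rightarrow> real^'nd \<Rightarrow> real"
    and Y :: "(real^'ny) set" and ct :: "real^'ny"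
    and gt :: "real^'ny \<Rightarrow> real^'nx \<Rightarrow> real^'nd \<Rightarrow> real"
    and d1 d2 d m :: nat and \<epsilon> :: real
  assumes prob: "prob_space M"
    (* (i) *)
    and X_convex: "convex X"
    and g_convex: "\<And>\<delta>. \<delta> \<in> space M \<Longrightarrow> convex_on X (\<lambda>x. g x \<delta>)"
    and P_interior: "\<And>\<omega>. \<omega> \<in> space (multisample M m) \<Longrightarrow>
          interior (scenario_feasible X g (\<omega> ` {1..m})) \<noteq> {}"
    and P_unique: "\<And>\<omega>. \<omega> \<in> space (multisample M m) \<Longrightarrow>
          scenario_minimizer_unique X c g (\<omega> ` {1..m})"
    (* (ii) *)
    and Y_convex: "convex Y"
    and gt_convex: "\<And>x \<delta>. x \<in> X \<Longrightarrow> \<delta> \<in> space M \<Longrightarrow> convex_on Y (\<lambda>y. gt y x \<delta>)"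
    and Pt_interior: "\<And>x \<omega>. x \<in> X \<Longrightarrow> \<omega> \<in> space (multisample M m) \<Longrightarrow>
          interior (scenario_feasible Y (\<lambda>y \<delta>. gt y x \<delta>) (\<omega> ` {1..m})) \<noteq> {}"
    and Pt_unique: "\<And>x \<omega>. x \<in> X \<Longrightarrow> \<omega> \<in> space (multisample M m) \<Longrightarrow>
          scenario_minimizer_unique Y ct (\<lambda>y \<delta>. gt y x \<delta>) (\<omega> ` {1..m})"
    (* The minimizers defining the compression maps exist. For positive sizes (at most m) this
       follows from (i) and (ii) by repeating samples; it matters only for d1 = 0 or d2 = 0. *)
    and d1_defined: "\<And>\<omega>. \<omega> \<in> space (multisample M d1) \<Longrightarrow>
          scenario_minimizer_unique X c g (\<omega> ` {1..d1})"
    and d2_defined: "\<And>x \<omega>. x \<in> X \<Longrightarrow> \<omega> \<in> space (multisample M d2) \<Longrightarrow>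
          scenario_minimizer_unique Y ct (\<lambda>y \<delta>. gt y x \<delta>) (\<omega> ` {1..d2})"
    and d1_compression: "compression_property M (space M) m d1 (scenario_map M X c g)"
    and d2_le: "d2 \<le> CARD('ny)"
    and d2_compression: "compression_property_family M (space M) m d2 X
          (\<lambda>x. scenario_map M Y ct (\<lambda>y \<delta>. gt y x \<delta>))"
    (* measurability of the sets involved; the third one is what conditioning on d samples needs *)
    and g_meas: "\<And>x. x \<in> X \<Longrightarrow> {\<delta> \<in> space M. g x \<delta> \<le> 0} \<in> sets M"
    and gt_meas: "\<And>x y. x \<in> X \<Longrightarrow> y \<in> Y \<Longrightarrow> {\<delta> \<in> space M. gt y x \<delta> \<le> 0} \<in> sets M"
    and subsample_meas: "{(\<omega>, \<delta>). \<omega> \<in> space (multisample M d) \<and> \<delta> \<in> space M \<and>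
          cascade_violated X c g Y ct gt (\<omega> ` {1..d}) \<delta>} \<in> sets (multisample M d \<Otimes>\<^sub>M M)"
    and event_meas: "{\<omega> \<in> space (multisample M m).
          measure M {\<delta> \<in> space M. cascade_violated X c g Y ct gt (\<omega> ` {1..m}) \<delta>} > \<epsilon>}
          \<in> sets (multisample M m)"
    and d_def: "d = d1 + d2" and m_ge: "d \<le> m"
    and eps: "0 < \<epsilon>" "\<epsilon> < 1"
  shows "measure (multisample M m) {\<omega> \<in> space (multisample M m).
           measure M {\<delta> \<in> space M. cascade_violated X c g Y ct gt (\<omega> ` {1..m}) \<delta>} > \<epsilon>}
         \<le> real (m choose d) * (1 - \<epsilon>) ^ (m - d)"
proof -
  interpret prob_space M by (rule prob)
  let ?P = "multisample M m"
  interpret P: prob_space ?P by (rule prob_space_PiM) (rule prob)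
  define V where "V = cascade_violated X c g Y ct gt"
  define E where "E = {\<omega> \<in> space ?P. measure M {\<delta> \<in> space M. V (\<omega> ` {1..m}) \<delta>} > \<epsilon>}"
  define A where "A I = {\<omega> \<in> space ?P. measure M {\<delta> \<in> space M. V (\<omega> ` I) \<delta>} > \<epsilon> \<and>
      (\<forall>j\<in>{1..m} - I. \<not> V (\<omega> ` I) (\<omega> j))}" for I
  define \<I> where "\<I> = {I. I \<subseteq> {1..m} \<and> card I = d}"
  have fin: "finite \<I>" unfolding \<I>_def by simp
  have A_meas: "A I \<in> sets ?P" and A_le: "measure ?P (A I) \<le> (1 - \<epsilon>) ^ (m - d)" if "I \<in> \<I>" for I
    using that eps prob_subsample_consistent_le[OF prob _ _ subsample_meas, of I m \<epsilon>]
    unfolding A_def V_def \<I>_def by auto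
  have "AE \<omega> in ?P. compresses (space M) m d1 (scenario_map M X c g) \<omega>"
    using d1_compression d_def m_ge unfolding compression_property_def by auto
  moreover have "AE \<omega> in ?P. \<forall>x\<in>X.
      compresses (space M) m d2 (scenario_map M Y ct (\<lambda>y \<delta>. gt y x \<delta>)) \<omega>"
    using d2_compression d_def m_ge unfolding compression_property_family_def by auto
  \<comment> \<open>The index set may depend on \<open>\<omega>\<close>; the union over all of
    \<open>\<I>\<close> absorbs this dependence, leaving a fixed \<open>I\<close> in each event to
    be bounded.\<close>
  ultimately have "AE \<omega> in ?P. \<omega> \<in> E \<longrightarrow> \<omega> \<in> (\<Union>I\<in>\<I>. A I)"
  proof (eventually_elim, intro impI)
    fix \<omega>
    assume c1: "compresses (space M) m d1 (scenario_map M X c g) \<omega>"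
      and c2: "\<forall>x\<in>X. compresses (space M) m d2 (scenario_map M Y ct (\<lambda>y \<delta>. gt y x \<delta>)) \<omega>"
      and "\<omega> \<in> E"
    then have \<omega>: "\<omega> \<in> space ?P" by (simp add: E_def)
    define x where "x = scenario_minimizer X c g (\<omega> ` {1..m})"
    let ?gx = "\<lambda>y \<delta>. gt y x \<delta>"
    obtain I1 where I1: "I1 \<subseteq> {1..m}" "card I1 = d1"
      and x: "x \<in> scenario_feasible X g (\<omega> ` {1..m})"
      and x_eq: "\<And>J. I1 \<subseteq> J \<Longrightarrow> J \<subseteq> {1..m} \<Longrightarrow> scenario_minimizer X c g (\<omega> ` J) = x"
      using multisample_minimizer_compressed[OF \<omega> d1_defined c1] unfolding x_def by metis
    have "x \<in> X" using x by (simp add: scenario_feasible_def)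
    define y where "y = scenario_minimizer Y ct ?gx (\<omega> ` {1..m})"
    \<comment> \<open>The parameter \<open>x\<close> depends on \<open>\<omega>\<close>, yet
      \<open>c2\<close> applies to it because its quantifier over \<open>X\<close> stands inside the
      almost-sure statement.\<close>
    obtain I2 where I2: "I2 \<subseteq> {1..m}" "card I2 = d2"
      and y: "y \<in> scenario_feasible Y ?gx (\<omega> ` {1..m})"
      and y_eq: "\<And>J. I2 \<subseteq> J \<Longrightarrow> J \<subseteq> {1..m} \<Longrightarrow> scenario_minimizer Y ct ?gx (\<omega> ` J) = y"
      using multisample_minimizer_compressed[OF \<omega> d2_defined[OF \<open>x \<in> X\<close>] bspec[OF c2 \<open>x \<in> X\<close>]]
      unfolding y_def by metis
    have "card (I1 \<union> I2) \<le> d"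
      using card_Un_le[of I1 I2] I1 I2 d_def by simp
    \<comment> \<open>\<open>I1\<close> and \<open>I2\<close> may overlap, so the union is padded to
      exactly \<open>d\<close> indices, which \<open>d \<le> m\<close> permits.\<close>
    then obtain I where I: "I1 \<union> I2 \<subseteq> I" "I \<subseteq> {1..m}" "card I = d"
      using exists_subset_between[of "I1 \<union> I2" d "{1..m}"] I1 I2 m_ge by auto
    have V_eq: "V (\<omega> ` J) \<delta> \<longleftrightarrow> g x \<delta> > 0 \<or> gt y x \<delta> > 0" if "I \<subseteq> J" "J \<subseteq> {1..m}" for J \<delta>
      using that I x_eq[of J] y_eq[of J] by (auto simp: V_def cascade_violated_def Let_def)
    have "V (\<omega> ` I) = V (\<omega> ` {1..m})"
      using V_eq[of I] V_eq[of "{1..m}"] I by auto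
    \<comment> \<open>Both minimizers are feasible for the full multisample, so none of its samples
      is violated.\<close>
    moreover have "\<not> V (\<omega> ` I) (\<omega> j)" if "j \<in> {1..m}" for j
    proof -
      have "\<omega> j \<in> \<omega> ` {1..m}" using that by blast
      then have "g x (\<omega> j) \<le> 0" "gt y x (\<omega> j) \<le> 0"
        using x y unfolding scenario_feasible_def by blast+
      then show ?thesis using V_eq[of I "\<omega> j"] I by auto
    qed
    ultimately have "\<omega> \<in> A I" using \<open>\<omega> \<in> E\<close> by (simp add: A_def E_def)
    then show "\<omega> \<in> (\<Union>I\<in>\<I>. A I)" using I by (auto simp: \<I>_def)
  qed
  then have "measure ?P E \<le> measure ?P (\<Union>I\<in>\<I>. A I)"
    using A_meas fin by (intro P.finite_measure_mono_AE) auto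
  also have "\<dots> \<le> (\<Sum>I\<in>\<I>. measure ?P (A I))"
    using A_meas fin by (intro P.finite_measure_subadditive_finite) auto
  also have "\<dots> \<le> (\<Sum>I\<in>\<I>. (1 - \<epsilon>) ^ (m - d))"
    by (intro sum_mono A_le)
  also have "\<dots> = real (m choose d) * (1 - \<epsilon>) ^ (m - d)"
    by (simp add: \<I>_def n_subsets)
  finally show ?thesis unfolding E_def V_def .
qed

end
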